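(* Let $\mathfrak g$ be an $n$-Lie algebra and let $\omega:\bigwedge^n\mathfrak g\to\mathfrak g$ be a linear map. Then $\omega$ generates a $\lambda$-parameter infinitesimal deformation of $\mathfrak g$, i.e. for every $\lambda\in K$ the operation $$[x_1,\dots,x_n]_{\lambda,\omega}=[x_1,\dots,x_n]+\lambda\,\omega(x_1,\dots,x_n)$$ is an $n$-Lie bracket on $\mathfrak g$, if and only if both of the following hold: (i) $\omega$ itself defines an $n$-Lie algebra structure on $\mathfrak g$; (ii) $\omega$ is a 1-cocycle of $\mathfrak g$ with coefficients in the adjoint representation.
   Context: $K$ is a field of characteristic zero; vector spaces are over $K$; $n\ge2$. An $n$-Lie algebra is a vector space with an alternating $n$-linear bracket satisfying $[x_1,\dots,x_{n-1},[y_1,\dots,y_n]]=\sum_{i=1}^n[y_1,\dots,y_{i-1},[x_1,\dots,x_{n-1},y_i],y_{i+1},\dots,y_n]$. The adjoint representation is $\rho(x_1,\dots,x_{n-1})(x_n)=[x_1,\dots,x_n]$ on $\mathfrak g$ itself. For a representation $(V,\rho)$ of $\mathfrak g$, a linear map $\omega:\bigwedge^n\mathfrak g\to V$ is a 1-cocycle if for all $x_i,y_i\in\mathfrak g$ $$\omega(x_1,\dots,x_{n-1},[y_1,\dots,y_n])+\rho(x_1,\dots,x_{n-1})\omega(y_1,\dots,y_n)=\sum_{i=1}^n\omega(y_1,\dots,[x_1,\dots,x_{n-1},y_i],\dots,y_n)+\sum_{i=1}^n(-1)^{n-i}\rho(y_1,\dots,\widehat{y_i},\dots,y_n)\omega(x_1,\dots,x_{n-1},y_i).$$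 *)

theory Defs
  imports Complex_Main
begin

text \<open>
  An \<open>n\<close>-ary operation is a function on lists of which only the values on lists of
  length \<open>n\<close> matter. A linear map on the \<open>n\<close>-th exterior power of a vector space is
  represented by the corresponding alternating \<open>n\<close>-linear map.
\<close>

definition multilinear ::
  "('k::field \<Rightarrow> 'g::ab_group_add \<Rightarrow> 'g) \<Rightarrow> ('k \<Rightarrow> 'v::ab_group_add \<Rightarrow> 'v) \<Rightarrow>
   nat \<Rightarrow> ('g list \<Rightarrow> 'v) \<Rightarrow> bool"
  where "multilinear s1 s2 n f \<longleftrightarrow>
    (\<forall>xs i. length xs = n \<longrightarrow> i < n \<longrightarrow> Vector_Spaces.linear s1 s2 (\<lambda>x. f (xs[i := x])))"

definition alternating_multilinear ::
  "('k::field \<Rightarrow> 'g::ab_group_add \<Rightarrow> 'g) \<Rightarrow> ('k \<Rightarrow> 'v::ab_group_add \<Rightarrow> 'v) \<Rightarrow>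
   nat \<Rightarrow> ('g list \<Rightarrow> 'v) \<Rightarrow> bool"
  where "alternating_multilinear s1 s2 n f \<longleftrightarrow>
    multilinear s1 s2 n f \<and> (\<forall>xs. length xs = n \<longrightarrow> \<not> distinct xs \<longrightarrow> f xs = 0)"

locale n_lie_algebra = vector_space scale
  for scale :: "'k::field_char_0 \<Rightarrow> 'g::ab_group_add \<Rightarrow> 'g" +
  fixes n :: nat and bracket :: "'g list \<Rightarrow> 'g"
  assumes arity_ge_2: "n \<ge> 2"
    and alternating_bracket: "alternating_multilinear scale scale n bracket"
    and fundamental_identity:
      "\<And>xs ys. length xs = n - 1 \<Longrightarrow> length ys = n \<Longrightarrow>
        bracket (xs @ [bracket ys]) = (\<Sum>i<n. bracket (ys[i := bracket (xs @ [ys ! i])]))"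

definition adjoint_rep :: "('g list \<Rightarrow> 'g) \<Rightarrow> 'g list \<Rightarrow> 'g \<Rightarrow> 'g"
  where "adjoint_rep bracket xs x = bracket (xs @ [x])"

text \<open>
  The cocycle condition for coefficients in \<open>(V, \<rho>)\<close>, where \<open>s1\<close> and \<open>s2\<close> are the scalar
  multiplications of the algebra and of \<open>V\<close>. List positions start at \<open>0\<close>, so the sign
  \<open>(-1)^(n-i)\<close> of the \<open>i\<close>-th argument becomes \<open>(-1)^(n - Suc i)\<close>.
\<close>

definition one_cocycle ::
  "('k::field \<Rightarrow> 'g::ab_group_add \<Rightarrow> 'g) \<Rightarrow> ('k \<Rightarrow> 'v::ab_group_add \<Rightarrow> 'v) \<Rightarrow> nat \<Rightarrow>
   ('g list \<Rightarrow> 'g) \<Rightarrow> ('g list \<Rightarrow> 'v \<Rightarrow> 'v) \<Rightarrow> ('g list \<Rightarrow> 'v) \<Rightarrow> bool"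
  where "one_cocycle s1 s2 n bracket \<rho> \<omega> \<longleftrightarrow>
    alternating_multilinear s1 s2 n \<omega> \<and>
    (\<forall>xs ys. length xs = n - 1 \<longrightarrow> length ys = n \<longrightarrow>
      \<omega> (xs @ [bracket ys]) + \<rho> xs (\<omega> ys) =
        (\<Sum>i<n. \<omega> (ys[i := bracket (xs @ [ys ! i])])) +
        (\<Sum>i<n. s2 ((- 1) ^ (n - Suc i))
                  (\<rho> (take i ys @ drop (Suc i) ys) (\<omega> (xs @ [ys ! i])))))"

definition deformed_bracket ::
  "('k \<Rightarrow> 'g::ab_group_add \<Rightarrow> 'g) \<Rightarrow> ('g list \<Rightarrow> 'g) \<Rightarrow> ('g list \<Rightarrow> 'g) \<Rightarrow> 'k \<Rightarrow> 'g list \<Rightarrow> 'g"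
  where "deformed_bracket scale bracket \<omega> l xs = bracket xs + scale l (\<omega> xs)"

definition generates_infinitesimal_deformation ::
  "('k::field_char_0 \<Rightarrow> 'g::ab_group_add \<Rightarrow> 'g) \<Rightarrow> nat \<Rightarrow> ('g list \<Rightarrow> 'g) \<Rightarrow> ('g list \<Rightarrow> 'g) \<Rightarrow> bool"
  where "generates_infinitesimal_deformation scale n bracket \<omega> \<longleftrightarrow>
    (\<forall>l. n_lie_algebra scale n (deformed_bracket scale bracket \<omega> l))"

end

theory Submission
  imports Defs
begin

text \<open>
  The fundamental identity for a bracket \<open>f\<close> says that a quadratic expression in \<open>f\<close>
  vanishes. Polarised, this expression is the defect \<open>D f g\<close> below, in which \<open>f\<close> is the
  outer and \<open>g\<close> the inner operation; it is linear in \<open>g\<close> because \<open>f\<close> is multilinear,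
  and linear in \<open>f\<close> by inspection. Hence
  \[ D(b + l\omega, b + l\omega) = D(b,b) + l (D(b,\omega) + D(\omega,b)) + l^2 D(\omega,\omega), \]
  where \<open>D(b,b) = 0\<close> for the given \<open>n\<close>-Lie bracket \<open>b\<close>
  (\<open>fundamental_defect_deformed_bracket\<close>). Such a polynomial vanishes for all \<open>l\<close> exactly
  when both remaining coefficients do; over a field of characteristic zero the values
  \<open>l = 1\<close> and \<open>l = -1\<close> already separate them. The quadratic coefficient is the fundamental
  identity for \<open>\<omega>\<close>.

  The linear coefficient is the cocycle condition for the adjoint representation
  (\<open>one_cocycle_adjoint_iff\<close>). The two differ only in the place where \<open>\<omega> (xs @ [ys ! i])\<close>
  enters the bracket: at position \<open>i\<close> in the defect, at the end in the cocycle condition.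
  Moving it to the end crosses \<open>n - Suc i\<close> arguments, and an alternating map changes sign at
  each crossing (\<open>alternating_multilinear_move_last\<close>).
\<close>

section \<open>Alternating multilinear maps\<close>

lemma multilinear_slot_linear:
  assumes "multilinear s1 s2 n f" and "length as + length bs + 1 = n"
  shows "Vector_Spaces.linear s1 s2 (\<lambda>x. f (as @ x # bs))"
proof -
  have "Vector_Spaces.linear s1 s2 (\<lambda>x. f ((as @ 0 # bs)[length as := x]))"
    using assms(1)[unfolded multilinear_def, rule_format, of "as @ 0 # bs" "length as"] assms(2)
    by simp
  then show ?thesis by simp
qed

lemma multilinear_slot_add:
  assumes "multilinear s1 s2 n f" and "length as + length bs + 1 = n"
  shows "f (as @ (x + y) # bs) = f (as @ x # bs) + f (as @ y # bs)"
  using multilinear_slot_linear[OF assms] by (simp add: Vector_Spaces.linear_iff)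

lemma multilinear_update_add_scale:
  assumes "multilinear s1 s2 n f" and "length xs = n" and "i < n"
  shows "f (xs[i := x + s1 c y]) = f (xs[i := x]) + s2 c (f (xs[i := y]))"
  using assms unfolding multilinear_def by (simp add: Vector_Spaces.linear_iff)

lemma multilinear_last_add_scale:
  assumes "multilinear s1 s2 n f" and "length xs + 1 = n"
  shows "f (xs @ [x + s1 c y]) = f (xs @ [x]) + s2 c (f (xs @ [y]))"
  using multilinear_slot_linear[OF assms(1), of xs "[]"] assms(2)
  by (simp add: Vector_Spaces.linear_iff)

lemma multilinear_add_scale:
  assumes "multilinear s1 s2 n f" and "multilinear s1 s2 n g"
  shows "multilinear s1 s2 n (\<lambda>xs. f xs + s2 c (g xs))"
  unfolding multilinear_def
proof (intro allI impI)
  fix xs :: "'b list" and i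
  assume "length xs = n" "i < n"
  with assms have f: "Vector_Spaces.linear s1 s2 (\<lambda>x. f (xs[i := x]))"
    and g: "Vector_Spaces.linear s1 s2 (\<lambda>x. g (xs[i := x]))"
    unfolding multilinear_def by auto
  then interpret V: vector_space s2 by (simp add: Vector_Spaces.linear_iff)
  show "Vector_Spaces.linear s1 s2 (\<lambda>x. f (xs[i := x]) + s2 c (g (xs[i := x])))"
    using f g by (simp add: Vector_Spaces.linear_iff V.scale_right_distrib V.scale_left_commute
        algebra_simps)
qed

lemma alternating_multilinear_add_scale:
  assumes "vector_space s2"
    and "alternating_multilinear s1 s2 n f" and "alternating_multilinear s1 s2 n g"
  shows "alternating_multilinear s1 s2 n (\<lambda>xs. f xs + s2 c (g xs))"
proof -
  interpret V: vector_space s2 by fact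
  show ?thesis
    using assms(2,3) multilinear_add_scale
    unfolding alternating_multilinear_def by fastforce
qed

text \<open>
  Polarisation of the vanishing on repeated arguments: put \<open>x + y\<close> into both places and
  expand; the two terms with equal arguments drop out.
\<close>

lemma alternating_multilinear_swap_adjacent:
  assumes "alternating_multilinear s1 s2 n f" and "length as + length bs + 2 = n"
  shows "f (as @ x # y # bs) = - f (as @ y # x # bs)"
proof -
  have ml: "multilinear s1 s2 n f"
    using assms(1) by (simp add: alternating_multilinear_def)
  have zero: "f (as @ z # z # bs) = 0" for z
    using assms by (simp add: alternating_multilinear_def)
  have snd_add: "f (as @ u # (v + w) # bs) = f (as @ u # v # bs) + f (as @ u # w # bs)" for u v w
    using multilinear_slot_add[OF ml, of "as @ [u]" bs v w] assms(2) by simp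
  have fst_add: "f (as @ (v + w) # u # bs) = f (as @ v # u # bs) + f (as @ w # u # bs)" for u v w
    using multilinear_slot_add[OF ml, of as "u # bs" v w] assms(2) by simp
  have "0 = f (as @ (x + y) # (x + y) # bs)"
    by (simp only: zero)
  also have "\<dots> = (f (as @ x # x # bs) + f (as @ y # x # bs)) +
      (f (as @ x # y # bs) + f (as @ y # y # bs))"
    by (simp only: fst_add snd_add)
  also have "\<dots> = f (as @ x # y # bs) + f (as @ y # x # bs)"
    by (simp add: zero add.commute)
  finally show ?thesis
    by (metis eq_neg_iff_add_eq_0)
qed

lemma alternating_multilinear_move_last:
  assumes "vector_space s2" and "alternating_multilinear s1 s2 n f"
    and "length as + length bs + 1 = n"
  shows "f (as @ z # bs) = s2 ((- 1) ^ length bs) (f (as @ bs @ [z]))"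
  using assms(3)
proof (induction bs arbitrary: as)
  case Nil
  interpret V: vector_space s2 by fact
  show ?case by simp
next
  case (Cons b bs)
  interpret V: vector_space s2 by fact
  have "f (as @ z # b # bs) = - f ((as @ [b]) @ z # bs)"
    using alternating_multilinear_swap_adjacent[OF assms(2), of as bs z b] Cons.prems by simp
  also have "\<dots> = - s2 ((- 1) ^ length bs) (f ((as @ [b]) @ bs @ [z]))"
    using Cons.IH[of "as @ [b]"] Cons.prems by simp
  finally show ?case by simp
qed

section \<open>The polarised fundamental identity\<close>

definition fundamental_defect ::
  "nat \<Rightarrow> ('g list \<Rightarrow> 'g) \<Rightarrow> ('g list \<Rightarrow> 'g) \<Rightarrow> 'g list \<Rightarrow> 'g list \<Rightarrow> 'g::ab_group_add"
  where "fundamental_defect n f g xs ys =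
    f (xs @ [g ys]) - (\<Sum>i<n. f (ys[i := g (xs @ [ys ! i])]))"

lemma n_lie_algebra_iff_fundamental_defect:
  "n_lie_algebra s n f \<longleftrightarrow> vector_space s \<and> n \<ge> 2 \<and> alternating_multilinear s s n f \<and>
    (\<forall>xs ys. length xs = n - 1 \<longrightarrow> length ys = n \<longrightarrow> fundamental_defect n f f xs ys = 0)"
  by (auto simp: n_lie_algebra_def n_lie_algebra_axioms_def fundamental_defect_def)

lemma fundamental_defect_outer_add_scale:
  assumes "vector_space s"
  shows "fundamental_defect n (\<lambda>zs. f zs + s c (h zs)) g xs ys =
    fundamental_defect n f g xs ys + s c (fundamental_defect n h g xs ys)"
proof -
  interpret V: vector_space s by fact
  show ?thesis
    by (simp add: fundamental_defect_def sum.distrib V.scale_right_diff_distrib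
        V.scale_sum_right)
qed

lemma fundamental_defect_inner_add_scale:
  assumes "vector_space s" and "multilinear s s n f" and "length xs + 1 = n" and "length ys = n"
  shows "fundamental_defect n f (\<lambda>zs. g zs + s c (h zs)) xs ys =
    fundamental_defect n f g xs ys + s c (fundamental_defect n f h xs ys)"
proof -
  interpret V: vector_space s by fact
  have "(\<Sum>i<n. f (ys[i := g (xs @ [ys ! i]) + s c (h (xs @ [ys ! i]))])) =
      (\<Sum>i<n. f (ys[i := g (xs @ [ys ! i])]) + s c (f (ys[i := h (xs @ [ys ! i])])))"
    by (rule sum.cong) (simp_all add: multilinear_update_add_scale[OF assms(2,4)])
  then show ?thesis
    by (simp add: fundamental_defect_def multilinear_last_add_scale[OF assms(2,3)] sum.distrib
        V.scale_right_diff_distrib V.scale_sum_right)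
qed

lemma fundamental_defect_deformed_bracket:
  assumes "vector_space s" and "multilinear s s n b" and "multilinear s s n \<omega>"
    and "length xs + 1 = n" and "length ys = n"
  shows "fundamental_defect n (deformed_bracket s b \<omega> l) (deformed_bracket s b \<omega> l) xs ys =
    fundamental_defect n b b xs ys +
    s l (fundamental_defect n b \<omega> xs ys + fundamental_defect n \<omega> b xs ys) +
    s (l * l) (fundamental_defect n \<omega> \<omega> xs ys)"
proof -
  interpret V: vector_space s by fact
  have d: "deformed_bracket s b \<omega> l = (\<lambda>zs. b zs + s l (\<omega> zs))"
    by (simp add: fun_eq_iff deformed_bracket_def)
  show ?thesis
    unfolding d fundamental_defect_outer_add_scale[OF assms(1)]
      fundamental_defect_inner_add_scale[OF assms(1,2,4,5)]
      fundamental_defect_inner_add_scale[OF assms(1,3,4,5)]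
    by (simp add: V.scale_right_distrib add.assoc)
qed

text \<open>
  In the cocycle condition the \<open>i\<close>-th signed term is \<open>b (ys[i := \<omega> (xs @ [ys ! i])])\<close> with
  its \<open>i\<close>-th argument moved to the end, so the sign is exactly the one that the alternating
  map \<open>b\<close> picks up.
\<close>

lemma one_cocycle_adjoint_iff:
  fixes s :: "'k::field \<Rightarrow> 'g::ab_group_add \<Rightarrow> 'g"
  assumes "vector_space s" and "alternating_multilinear s s n b"
    and "alternating_multilinear s s n \<omega>"
  shows "one_cocycle s s n b (adjoint_rep b) \<omega> \<longleftrightarrow>
    (\<forall>xs ys. length xs = n - 1 \<longrightarrow> length ys = n \<longrightarrow>
      fundamental_defect n b \<omega> xs ys + fundamental_defect n \<omega> b xs ys = 0)"
proof -
  have sign: "(\<Sum>i<n. s ((- 1) ^ (n - Suc i))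
        (b ((take i ys @ drop (Suc i) ys) @ [\<omega> (xs @ [ys ! i])]))) =
      (\<Sum>i<n. b (ys[i := \<omega> (xs @ [ys ! i])]))" if "length ys = n" for xs ys
  proof (rule sum.cong)
    fix i
    assume "i \<in> {..<n}"
    with that show "s ((- 1) ^ (n - Suc i))
        (b ((take i ys @ drop (Suc i) ys) @ [\<omega> (xs @ [ys ! i])])) =
        b (ys[i := \<omega> (xs @ [ys ! i])])"
      using alternating_multilinear_move_last[OF assms(1,2), of "take i ys" "drop (Suc i) ys"]
      by (simp add: upd_conv_take_nth_drop)
  qed simp
  have rearrange: "(p + q = r + t) = ((q - t) + (p - r) = 0)" for p q r t :: 'g
    by (auto simp: algebra_simps)
  show ?thesis
    using assms(3) unfolding one_cocycle_def adjoint_rep_def fundamental_defect_def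
    by (simp add: sign[simplified] rearrange)
qed

section \<open>Comparing coefficients\<close>

lemma quadratic_vanishes_iff:
  fixes s :: "'k::field_char_0 \<Rightarrow> 'v::ab_group_add \<Rightarrow> 'v"
  assumes "vector_space s"
  shows "(\<forall>l. s l u + s (l * l) v = 0) \<longleftrightarrow> u = 0 \<and> v = 0"
proof
  interpret V: vector_space s by fact
  assume all: "\<forall>l. s l u + s (l * l) v = 0"
  from all[rule_format, of 1] have plus: "u + v = 0" by simp
  from all[rule_format, of "- 1"] have minus: "v = u" by simp
  have "s 2 u = u + u"
    using V.scale_left_distrib[of 1 1 u] by simp
  with plus minus have "s 2 u = 0" by simp
  \<comment> \<open>Characteristic zero enters here, through the invertibility of \<open>2\<close>.\<close>
  then show "u = 0 \<and> v = 0" using minus by simp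
next
  interpret V: vector_space s by fact
  assume "u = 0 \<and> v = 0"
  then show "\<forall>l. s l u + s (l * l) v = 0" by simp
qed

theorem theorem2p10:
  fixes scale :: "'k::field_char_0 \<Rightarrow> 'g::ab_group_add \<Rightarrow> 'g"
    and n :: nat
    and bracket \<omega> :: "'g list \<Rightarrow> 'g"
  assumes "n_lie_algebra scale n bracket"
    and "alternating_multilinear scale scale n \<omega>"
  shows "generates_infinitesimal_deformation scale n bracket \<omega> \<longleftrightarrow>
    n_lie_algebra scale n \<omega> \<and>
    one_cocycle scale scale n bracket (adjoint_rep bracket) \<omega>"
proof -
  let ?D = "fundamental_defect n"
  let ?L = "\<lambda>xs ys. ?D bracket \<omega> xs ys + ?D \<omega> bracket xs ys"
  from assms(1) have vs: "vector_space scale" and n: "n \<ge> 2"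
    and alt: "alternating_multilinear scale scale n bracket"
    and fi: "\<And>xs ys. length xs = n - 1 \<Longrightarrow> length ys = n \<Longrightarrow> ?D bracket bracket xs ys = 0"
    by (simp_all add: n_lie_algebra_iff_fundamental_defect)
  have alt_deformed:
    "alternating_multilinear scale scale n (deformed_bracket scale bracket \<omega> l)" for l
    using alternating_multilinear_add_scale[OF vs alt assms(2), of l]
    by (simp add: deformed_bracket_def[abs_def])
  have defect: "?D (deformed_bracket scale bracket \<omega> l) (deformed_bracket scale bracket \<omega> l) xs ys =
      scale l (?L xs ys) + scale (l * l) (?D \<omega> \<omega> xs ys)"
    if "length xs = n - 1" "length ys = n" for l xs ys
    using fundamental_defect_deformed_bracket[OF vs, of n bracket \<omega> xs ys l] that n alt assms(2) fi
    by (simp add: alternating_multilinear_def)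
  have "generates_infinitesimal_deformation scale n bracket \<omega> \<longleftrightarrow>
      (\<forall>l xs ys. length xs = n - 1 \<longrightarrow> length ys = n \<longrightarrow>
        scale l (?L xs ys) + scale (l * l) (?D \<omega> \<omega> xs ys) = 0)"
    unfolding generates_infinitesimal_deformation_def n_lie_algebra_iff_fundamental_defect
    using vs n alt_deformed by (simp add: defect)
  also have "\<dots> \<longleftrightarrow> (\<forall>xs ys. length xs = n - 1 \<longrightarrow> length ys = n \<longrightarrow>
      (\<forall>l. scale l (?L xs ys) + scale (l * l) (?D \<omega> \<omega> xs ys) = 0))"
    by blast
  also have "\<dots> \<longleftrightarrow> (\<forall>xs ys. length xs = n - 1 \<longrightarrow> length ys = n \<longrightarrow>
      ?L xs ys = 0 \<and> ?D \<omega> \<omega> xs ys = 0)"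
    by (simp only: quadratic_vanishes_iff[OF vs])
  also have "\<dots> \<longleftrightarrow> n_lie_algebra scale n \<omega> \<and>
      one_cocycle scale scale n bracket (adjoint_rep bracket) \<omega>"
    unfolding n_lie_algebra_iff_fundamental_defect one_cocycle_adjoint_iff[OF vs alt assms(2)]
    using vs n assms(2) by blast
  finally show ?thesis .
qed

end
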